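(* Let $X$ be a complex Banach sequence space such that its canonical basis is a 1-unconditional Schauder basis and such that $\widehat{S}$ defines an action on $X$. Assume that the closed unit ball $\overline{B_X}$ is $\widehat{S}$-invariant. If $z$ is an element of $X$ outside $\overline{B_X}$, then $z$ can be separated from $\overline{B_X}$ by a homogeneous $\widehat{S}$-invariant continuous polynomial.
   Context: Fix a strictly increasing sequence of non-negative integers $(n_k)_{k=1}^\infty$ with $n_1=0$, and set $N_k=\{n_k+1,\ldots,n_{k+1}\}$ for $k\in\mathbb{N}$. $S$ is the group of permutations $\sigma$ of the natural numbers such that $\sigma(N_k)=N_k$ for each $k\in\mathbb{N}$. For $\sigma\in S$, $\widehat\sigma(x)=(x_{\sigma(j)})_{j=1}^\infty$ for $x=(x_j)_{j=1}^\infty\in X$, and $\widehat S=\{\widehat\sigma:\sigma\in S\}$. That $\widehat S$ defines an action on $X$ means that each $\widehat\sigma$ maps $X$ into $X$ (and is then continuous and linear). A set $K$ is $\widehat S$-invariant if $\gamma(K)\subset K$ for every $\gamma\in\widehat S$; a (complex-valued) polynomial $P$ is $\widehat S$-invariant if $P\circ\gamma=P$ for every $\gamma\in\widehat S$. A polynomial $P$ separates a point $z$ and a set $K$ if $\sup_{w\in K}|P(w)|<|P(z)|$. *)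

theory Defs
  imports "HOL-Analysis.Analysis" "HOL-Library.Function_Algebras"
begin

(* Sequences are indexed from 0, so the block N_k = {n_k + 1, ..., n_(k+1)} becomes
   {n k ..< n (Suc k)}, with n 0 = 0. *)

type_synonym cseq = "nat \<Rightarrow> complex"

definition seq_scale :: "complex \<Rightarrow> cseq \<Rightarrow> cseq" where
  "seq_scale c x = (\<lambda>j. c * x j)"

lemma vector_space_seq_scale: "vector_space seq_scale"
  by unfold_locales (auto simp: seq_scale_def fun_eq_iff algebra_simps)

(* Metric_space requires the distance to be nonnegative and symmetric on the whole type,
   while nrm is only meaningful on X; hence the conditional. *)
definition seq_dist :: "cseq set \<Rightarrow> (cseq \<Rightarrow> real) \<Rightarrow> cseq \<Rightarrow> cseq \<Rightarrow> real" where
  "seq_dist X nrm x y = (if x \<in> X \<and> y \<in> X then nrm (x - y) else 0)"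

definition seq_topology :: "cseq set \<Rightarrow> (cseq \<Rightarrow> real) \<Rightarrow> cseq topology" where
  "seq_topology X nrm = Metric_space.mtopology X (seq_dist X nrm)"

locale complex_normed_sequence_space =
  fixes X :: "cseq set" and nrm :: "cseq \<Rightarrow> real"
  assumes subspace: "module.subspace seq_scale X"
    and nrm_nonneg: "x \<in> X \<Longrightarrow> 0 \<le> nrm x"
    and nrm_eq_0_iff: "x \<in> X \<Longrightarrow> nrm x = 0 \<longleftrightarrow> x = 0"
    and nrm_scale: "x \<in> X \<Longrightarrow> nrm (seq_scale c x) = cmod c * nrm x"
    and nrm_triangle: "x \<in> X \<Longrightarrow> y \<in> X \<Longrightarrow> nrm (x + y) \<le> nrm x + nrm y"
begin

lemma Metric_space_seq_dist: "Metric_space X (seq_dist X nrm)"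
proof -
  interpret vector_space seq_scale by (rule vector_space_seq_scale)
  have diff: "x - y \<in> X" if "x \<in> X" "y \<in> X" for x y
    using subspace_diff[OF subspace that] .
  have comm: "nrm (x - y) = nrm (y - x)" if "x \<in> X" "y \<in> X" for x y
    using nrm_scale[OF diff[OF that], of "-1"] by simp
  show ?thesis
  proof
    fix x y z
    show "0 \<le> seq_dist X nrm x y" by (simp add: seq_dist_def nrm_nonneg diff)
    show "seq_dist X nrm x y = seq_dist X nrm y x" by (simp add: seq_dist_def comm)
    assume "x \<in> X" "y \<in> X"
    then show "(seq_dist X nrm x y = 0) = (x = y)"
      by (simp add: seq_dist_def nrm_eq_0_iff diff)
    assume "z \<in> X"
    then show "seq_dist X nrm x z \<le> seq_dist X nrm x y + seq_dist X nrm y z"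
      using nrm_triangle[OF diff[OF \<open>x \<in> X\<close> \<open>y \<in> X\<close>] diff[OF \<open>y \<in> X\<close> \<open>z \<in> X\<close>]]
        \<open>x \<in> X\<close> \<open>y \<in> X\<close> by (simp add: seq_dist_def)
  qed
qed

end

locale complex_banach_sequence_space = complex_normed_sequence_space +
  assumes complete: "Metric_space.mcomplete X (seq_dist X nrm)"

definition unit_cball :: "cseq set \<Rightarrow> (cseq \<Rightarrow> real) \<Rightarrow> cseq set" where
  "unit_cball X nrm = {x \<in> X. nrm x \<le> 1}"

definition series_converges_to ::
    "cseq set \<Rightarrow> (cseq \<Rightarrow> real) \<Rightarrow> (nat \<Rightarrow> cseq) \<Rightarrow> (nat \<Rightarrow> complex) \<Rightarrow> cseq \<Rightarrow> bool" where
  "series_converges_to X nrm b a x \<longleftrightarrow>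
     limitin (seq_topology X nrm) (\<lambda>m. \<Sum>j<m. seq_scale (a j) (b j)) x sequentially"

definition schauder_basis :: "cseq set \<Rightarrow> (cseq \<Rightarrow> real) \<Rightarrow> (nat \<Rightarrow> cseq) \<Rightarrow> bool" where
  "schauder_basis X nrm b \<longleftrightarrow>
     (\<forall>j. b j \<in> X) \<and> (\<forall>x\<in>X. \<exists>!a. series_converges_to X nrm b a x)"

(* The scalars are complex and compared in modulus; for C = 1 this is invariance of the norm
   under multiplication of the coefficients by arbitrary unimodular complex numbers. *)
definition unconditional_with_constant ::
    "(cseq \<Rightarrow> real) \<Rightarrow> real \<Rightarrow> (nat \<Rightarrow> cseq) \<Rightarrow> bool" where
  "unconditional_with_constant nrm C b \<longleftrightarrow>
     (\<forall>m (a :: nat \<Rightarrow> complex) a'. (\<forall>j<m. cmod (a j) \<le> cmod (a' j)) \<longrightarrow>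
        nrm (\<Sum>j<m. seq_scale (a j) (b j)) \<le> C * nrm (\<Sum>j<m. seq_scale (a' j) (b j)))"

definition unit_seq :: "nat \<Rightarrow> cseq" where
  "unit_seq j = (\<lambda>i. if i = j then 1 else 0)"

(* The last conjunct says that the coefficients of x with respect to the canonical basis are
   the entries of x. It has to be stated: a bare norm on a space of sequences need not make
   the coordinate functionals continuous. *)
definition canonical_basis_is_schauder :: "cseq set \<Rightarrow> (cseq \<Rightarrow> real) \<Rightarrow> bool" where
  "canonical_basis_is_schauder X nrm \<longleftrightarrow>
     schauder_basis X nrm unit_seq \<and> (\<forall>x\<in>X. series_converges_to X nrm unit_seq x x)"

definition block :: "(nat \<Rightarrow> nat) \<Rightarrow> nat \<Rightarrow> nat set" where
  "block n k = {n k..<n (Suc k)}"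

definition block_perms :: "(nat \<Rightarrow> nat) \<Rightarrow> (nat \<Rightarrow> nat) set" where
  "block_perms n = {\<sigma>. bij \<sigma> \<and> (\<forall>k. \<sigma> ` block n k = block n k)}"

definition hat :: "(nat \<Rightarrow> nat) \<Rightarrow> cseq \<Rightarrow> cseq" where
  "hat \<sigma> x = (\<lambda>j. x (\<sigma> j))"

definition hat_S :: "(nat \<Rightarrow> nat) \<Rightarrow> (cseq \<Rightarrow> cseq) set" where
  "hat_S n = hat ` block_perms n"

definition defines_action :: "(cseq \<Rightarrow> cseq) set \<Rightarrow> cseq set \<Rightarrow> bool" where
  "defines_action G X \<longleftrightarrow> (\<forall>\<gamma>\<in>G. \<gamma> ` X \<subseteq> X)"

definition invariant_set :: "(cseq \<Rightarrow> cseq) set \<Rightarrow> cseq set \<Rightarrow> bool" where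
  "invariant_set G K \<longleftrightarrow> (\<forall>\<gamma>\<in>G. \<gamma> ` K \<subseteq> K)"

definition invariant_fun ::
    "(cseq \<Rightarrow> cseq) set \<Rightarrow> cseq set \<Rightarrow> (cseq \<Rightarrow> complex) \<Rightarrow> bool" where
  "invariant_fun G X P \<longleftrightarrow> (\<forall>\<gamma>\<in>G. \<forall>x\<in>X. P (\<gamma> x) = P x)"

(* The arguments of an m-linear form are given as a list of length m. *)
definition multilinear_form :: "cseq set \<Rightarrow> nat \<Rightarrow> (cseq list \<Rightarrow> complex) \<Rightarrow> bool" where
  "multilinear_form X m A \<longleftrightarrow>
     (\<forall>v i. length v = m \<and> set v \<subseteq> X \<and> i < m \<longrightarrow>
        (\<forall>x\<in>X. \<forall>y\<in>X. A (v[i := x + y]) = A (v[i := x]) + A (v[i := y])) \<and>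
        (\<forall>c. \<forall>x\<in>X. A (v[i := seq_scale c x]) = c * A (v[i := x])))"

definition homogeneous_polynomial ::
    "cseq set \<Rightarrow> nat \<Rightarrow> (cseq \<Rightarrow> complex) \<Rightarrow> bool" where
  "homogeneous_polynomial X m P \<longleftrightarrow>
     (\<exists>A. multilinear_form X m A \<and> (\<forall>x\<in>X. P x = A (replicate m x)))"

definition continuous_homogeneous_polynomial ::
    "cseq set \<Rightarrow> (cseq \<Rightarrow> real) \<Rightarrow> nat \<Rightarrow> (cseq \<Rightarrow> complex) \<Rightarrow> bool" where
  "continuous_homogeneous_polynomial X nrm m P \<longleftrightarrow>
     homogeneous_polynomial X m P \<and> continuous_map (seq_topology X nrm) euclidean P"

(* The supremum is taken in the extended reals, so that it is infinite when P is unbounded on K. *)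
definition separates :: "(cseq \<Rightarrow> complex) \<Rightarrow> cseq \<Rightarrow> cseq set \<Rightarrow> bool" where
  "separates P z K \<longleftrightarrow> (SUP w\<in>K. ereal (cmod (P w))) < ereal (cmod (P z))"

end

theory Submission
  imports Defs "HOL-Analysis.Kronecker_Approximation_Theorem" "HOL-Combinatorics.Permutations"
begin

text \<open>
  By convergence of the basis expansion, a truncation of z to the first M coordinates, where M is
  the end of a block, still has norm greater than 1. By 1-unconditionality a supporting real
  functional of the norm at the moduli of these coordinates, twisted by their phases, is a complex
  functional \<open>\<phi>\<close> on the first M coordinates with \<open>\<bar>\<phi>\<bar> \<le> nrm\<close> and \<open>\<phi> z > 1\<close>. The polynomial
  \<open>P = (\<Sum>\<sigma>. (\<phi> \<circ> \<sigma>) ^ k)\<close>, with \<open>\<sigma>\<close> ranging over the finite group of block permutations of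
  the first M coordinates, is invariant and bounded on the ball by the order of this group.
  Simultaneous Diophantine approximation of the arguments of the numbers \<open>\<phi> (\<sigma> z)\<close> yields exponents
  k for which there is no cancellation in \<open>P z\<close>, so that \<open>\<bar>P z\<bar>\<close> grows like \<open>\<phi> z ^ k\<close>.
\<close>

section \<open>Linear minorants of sublinear functionals\<close>

definition sublinear :: "(('i \<Rightarrow> real) \<Rightarrow> real) \<Rightarrow> bool" where
  "sublinear p \<longleftrightarrow>
     (\<forall>s t. p (\<lambda>i. s i + t i) \<le> p s + p t) \<and> (\<forall>c\<ge>0. \<forall>t. p (\<lambda>i. c * t i) = c * p t)"

lemma sublinear_add: "sublinear p \<Longrightarrow> p (\<lambda>i. s i + t i) \<le> p s + p t"
  by (simp add: sublinear_def)

lemma sublinear_scale: "sublinear p \<Longrightarrow> c \<ge> 0 \<Longrightarrow> p (\<lambda>i. c * t i) = c * p t"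
  by (simp add: sublinear_def)

lemma sublinear_zero: "sublinear p \<Longrightarrow> p (\<lambda>_. 0) = 0"
  using sublinear_scale[of p 0] by simp

text \<open>Applying \<open>scale\<close> with \<open>inverse c\<close> to the already scaled
  argument gives the reverse inequality.\<close>

lemma sublinearI:
  assumes add: "\<And>s t. p (\<lambda>i. s i + t i) \<le> p s + p t"
    and zero: "p (\<lambda>_. 0) = 0"
    and scale: "\<And>c t. c > 0 \<Longrightarrow> p (\<lambda>i. c * t i) \<le> c * p t"
  shows "sublinear p"
proof -
  have "p (\<lambda>i. c * t i) = c * p t" if "c \<ge> 0" for c t
  proof (cases "c = 0")
    case False
    then have "c > 0" using that by simp
    have "p (\<lambda>i. inverse c * (c * t i)) \<le> inverse c * p (\<lambda>i. c * t i)"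
      using \<open>c > 0\<close> by (intro scale) simp
    then have "c * p t \<le> p (\<lambda>i. c * t i)"
      using \<open>c > 0\<close> by (simp add: field_simps)
    then show ?thesis using scale[OF \<open>c > 0\<close>, of t] by simp
  qed (simp add: zero)
  then show ?thesis using add by (simp add: sublinear_def)
qed

text \<open>The one-step Hahn-Banach construction: \<open>q\<close> is the infimum over
  \<open>s \<ge> 0\<close> of \<open>p (t + s z) - s * p z\<close>. Together with
  \<open>q z \<le> p z\<close>, the last property makes \<open>q\<close> linear on the line through
  \<open>z\<close>.\<close>

lemma sublinear_flatten:
  fixes p :: "('i \<Rightarrow> real) \<Rightarrow> real"
  assumes p: "sublinear p"
  obtains q where "sublinear q" "\<And>t. q t \<le> p t" "q (\<lambda>i. - z i) \<le> - p z"
proof -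
  define g where "g t s = p (\<lambda>i. t i + s * z i) - s * p z" for t s
  define q where "q t = (INF s\<in>{0..}. g t s)" for t
  \<comment> \<open>Subadditivity at \<open>s z = (t + s z) + (- t)\<close> gives a lower bound
    independent of \<open>s\<close>, so the infimum is finite.\<close>
  have lower: "- p (\<lambda>i. - t i) \<le> g t s" if "s \<ge> 0" for t s
    using sublinear_add[OF p, of "\<lambda>i. t i + s * z i" "\<lambda>i. - t i"] sublinear_scale[OF p that, of z]
    by (simp add: g_def)
  have le: "q t \<le> g t s" if "s \<ge> 0" for t s
    unfolding q_def using that lower by (intro cINF_lower bdd_belowI2[of _ "- p (\<lambda>i. - t i)"]) auto
  have ge: "c \<le> q t" if "\<And>s. s \<ge> 0 \<Longrightarrow> c \<le> g t s" for c t
    unfolding q_def using that by (intro cINF_greatest) auto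
  have "sublinear q"
  proof (rule sublinearI)
    fix s t :: "'i \<Rightarrow> real"
    have *: "q (\<lambda>i. s i + t i) \<le> g s a + g t b" if "a \<ge> 0" "b \<ge> 0" for a b
    proof -
      have "q (\<lambda>i. s i + t i) \<le> g (\<lambda>i. s i + t i) (a + b)" using that by (intro le) simp
      also have "\<dots> \<le> g s a + g t b"
        using sublinear_add[OF p, of "\<lambda>i. s i + a * z i" "\<lambda>i. t i + b * z i"]
        by (simp add: g_def algebra_simps)
      finally show ?thesis .
    qed
    \<comment> \<open>Take the infimum over \<open>a\<close> first, then over
      \<open>b\<close>.\<close>
    have "q (\<lambda>i. s i + t i) - g t b \<le> q s" if "b \<ge> 0" for b
      using *[OF _ that] by (intro ge) (simp add: algebra_simps)
    then have "q (\<lambda>i. s i + t i) - q s \<le> q t"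
      by (intro ge) (simp add: algebra_simps)
    then show "q (\<lambda>i. s i + t i) \<le> q s + q t" by simp
  next
    have "g (\<lambda>_. 0) s = 0" if "s \<ge> 0" for s
      using sublinear_scale[OF p that, of z] by (simp add: g_def)
    then show "q (\<lambda>_. 0) = 0" by (simp add: q_def)
  next
    fix c :: real and t :: "'i \<Rightarrow> real" assume "c > 0"
    have "q (\<lambda>i. c * t i) \<le> c * g t s" if "s \<ge> 0" for s
    proof -
      have "q (\<lambda>i. c * t i) \<le> g (\<lambda>i. c * t i) (c * s)" using that \<open>c > 0\<close> by (intro le) simp
      also have "\<dots> = c * g t s"
        using sublinear_scale[OF p, of c "\<lambda>i. t i + s * z i"] \<open>c > 0\<close>
        by (simp add: g_def algebra_simps)
      finally show ?thesis .
    qed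
    then have "q (\<lambda>i. c * t i) / c \<le> q t"
      using \<open>c > 0\<close> by (intro ge) (simp add: field_simps)
    then show "q (\<lambda>i. c * t i) \<le> c * q t" using \<open>c > 0\<close> by (simp add: field_simps)
  qed
  moreover have "q t \<le> p t" for t using le[of 0 t] by (simp add: g_def)
  \<comment> \<open>At parameter \<open>s = 1\<close> the argument \<open>- z + s z\<close>
    vanishes.\<close>
  moreover have "q (\<lambda>i. - z i) \<le> - p z"
    using le[of 1 "\<lambda>i. - z i"] sublinear_zero[OF p] by (simp add: g_def)
  ultimately show thesis by (rule that)
qed

text \<open>Induction on \<open>I\<close>: flatten \<open>p\<close> along the unit vector
  \<open>e\<close> of the new index \<open>j\<close>, so that the result \<open>q\<close> is linear
  on that line. The coefficient at \<open>j\<close> is \<open>q e\<close>; the others come from the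
  induction hypothesis for \<open>q\<close>, applied to \<open>t - t j * e\<close>, which vanishes
  at \<open>j\<close>.\<close>

lemma sublinear_linear_minorant:
  fixes p :: "('i \<Rightarrow> real) \<Rightarrow> real"
  assumes "finite I" "sublinear p"
  shows "\<exists>a. \<forall>t. (\<forall>i. i \<notin> I \<longrightarrow> t i = 0) \<longrightarrow> (\<Sum>i\<in>I. a i * t i) \<le> p t"
  using assms
proof (induction I arbitrary: p rule: finite_induct)
  case empty
  then have "p t = 0" if "\<forall>i. t i = 0" for t
    using sublinear_zero[of p] that by (metis ext)
  then show ?case by simp
next
  case (insert j I)
  define e :: "'i \<Rightarrow> real" where "e = (\<lambda>i. if i = j then 1 else 0)"
  obtain q where q: "sublinear q" and qp: "\<And>t. q t \<le> p t" and "q (\<lambda>i. - e i) \<le> - p e"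
    using sublinear_flatten[OF insert.prems] by blast
  then have qe: "q (\<lambda>i. - e i) \<le> - q e" using qp[of e] by linarith
  \<comment> \<open>Flattening matters for negative \<open>c\<close>, where mere sublinearity gives
    the opposite inequality.\<close>
  have line: "q (\<lambda>i. c * e i) \<le> c * q e" for c
  proof (cases "c \<ge> 0")
    case False
    then have "q (\<lambda>i. (- c) * (- e i)) = (- c) * q (\<lambda>i. - e i)"
      by (intro sublinear_scale[OF q]) simp
    also have "\<dots> \<le> (- c) * (- q e)" using qe False by (intro mult_left_mono) auto
    finally show ?thesis by simp
  qed (simp add: sublinear_scale[OF q])
  obtain a where a: "\<And>t. (\<forall>i. i \<notin> I \<longrightarrow> t i = 0) \<Longrightarrow> (\<Sum>i\<in>I. a i * t i) \<le> q t"
    using insert.IH[OF q] by blast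
  have "(\<Sum>i\<in>insert j I. (a(j := q e)) i * t i) \<le> p t" if t: "\<forall>i. i \<notin> insert j I \<longrightarrow> t i = 0" for t
  proof -
    let ?t = "\<lambda>i. t i + (- t j) * e i"
    have "(\<Sum>i\<in>insert j I. (a(j := q e)) i * t i) = q e * t j + (\<Sum>i\<in>I. (a(j := q e)) i * t i)"
      using insert.hyps by simp
    also have "(\<Sum>i\<in>I. (a(j := q e)) i * t i) = (\<Sum>i\<in>I. a i * ?t i)"
      using insert.hyps(2) by (intro sum.cong refl) (auto simp: e_def)
    also have "\<dots> \<le> q ?t" using t by (intro a) (auto simp: e_def)
    also have "\<dots> \<le> q t + (- t j) * q e"
      using sublinear_add[OF q, of t "\<lambda>i. (- t j) * e i"] line[of "- t j"] by simp
    finally show ?thesis using qp[of t] by (simp add: mult.commute)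
  qed
  then show ?case by blast
qed

text \<open>Finite-dimensional Hahn-Banach at a given point: a linear minorant of \<open>p\<close>
  flattened along \<open>z\<close> is at most \<open>- p z\<close> at \<open>- z\<close>, hence at
  least \<open>p z\<close> at \<open>z\<close>.\<close>

lemma sublinear_supporting_functional:
  fixes p :: "('i \<Rightarrow> real) \<Rightarrow> real"
  assumes "finite I" "sublinear p" and z: "\<And>i. i \<notin> I \<Longrightarrow> z i = 0"
  obtains a where "\<And>t. (\<And>i. i \<notin> I \<Longrightarrow> t i = 0) \<Longrightarrow> (\<Sum>i\<in>I. a i * t i) \<le> p t"
    and "(\<Sum>i\<in>I. a i * z i) = p z"
proof -
  obtain q where q: "sublinear q" and qp: "\<And>t. q t \<le> p t" and qz: "q (\<lambda>i. - z i) \<le> - p z"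
    using sublinear_flatten[OF assms(2)] by blast
  obtain a where a: "\<And>t. (\<forall>i. i \<notin> I \<longrightarrow> t i = 0) \<Longrightarrow> (\<Sum>i\<in>I. a i * t i) \<le> q t"
    using sublinear_linear_minorant[OF assms(1) q] by blast
  have le: "(\<Sum>i\<in>I. a i * t i) \<le> p t" if "\<And>i. i \<notin> I \<Longrightarrow> t i = 0" for t
    using a[of t] qp[of t] that by fastforce
  have "(\<Sum>i\<in>I. a i * - z i) \<le> - p z" using a[of "\<lambda>i. - z i"] z qz by fastforce
  then have "(\<Sum>i\<in>I. a i * z i) = p z" using le[of z, OF z] by (simp add: sum_negf)
  with le show thesis by (rule that)
qed

section \<open>Power sums without cancellation\<close>

text \<open>Dirichlet's theorem supplies one exponent that brings all arguments within a sixth of a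
  turn of a multiple of \<open>2 * pi\<close>. The angle left is at most \<open>pi / 3\<close>,
  where the cosine is at least 1/2.\<close>

lemma power_sum_Re_lower_bound:
  fixes c :: "'s \<Rightarrow> complex"
  assumes "finite F"
  obtains q :: nat where "q > 0" "\<And>\<sigma>. \<sigma> \<in> F \<Longrightarrow> Re (c \<sigma> ^ q) \<ge> cmod (c \<sigma>) ^ q / 2"
proof -
  \<comment> \<open>The approximation theorem takes reals indexed by an initial segment of the
    naturals, so \<open>F\<close> is enumerated.\<close>
  obtain h :: "'s \<Rightarrow> nat" where h: "bij_betw h F {0..<card F}"
    using ex_bij_betw_finite_nat[OF assms] by blast
  define \<theta> where "\<theta> i = Arg (c (inv_into F h i)) / (2 * pi)" for i
  obtain q p where "0 < q" and qp: "\<And>i. i < card F \<Longrightarrow> \<bar>of_int q * \<theta> i - of_int (p i)\<bar> < 1 / real 6"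
    by (rule Dirichlet_approx_simult[of 6 "card F" \<theta>]) auto
  have "Re (c \<sigma> ^ nat q) \<ge> cmod (c \<sigma>) ^ nat q / 2" if "\<sigma> \<in> F" for \<sigma>
  proof -
    have "h \<sigma> < card F" and inv: "inv_into F h (h \<sigma>) = \<sigma>"
      using h that by (auto simp: bij_betw_def)
    define \<delta> where "\<delta> = real_of_int q * \<theta> (h \<sigma>) - of_int (p (h \<sigma>))"
    have \<delta>: "\<bar>\<delta>\<bar> < 1 / 6" using qp[OF \<open>h \<sigma> < card F\<close>] by (simp add: \<delta>_def)
    have "real (nat q) * Arg (c \<sigma>) = 2 * pi * (real_of_int q * \<theta> (h \<sigma>))"
      using \<open>0 < q\<close> by (simp add: \<theta>_def inv)
    also have "\<dots> = 2 * pi * \<delta> + 2 * pi * of_int (p (h \<sigma>))" by (simp add: \<delta>_def algebra_simps)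
    finally have arg: "cos (real (nat q) * Arg (c \<sigma>)) = cos (2 * pi * \<delta>)"
      by (simp add: cos_add)
    have "2 * pi * \<bar>\<delta>\<bar> \<le> pi / 3" using \<delta> by (simp add: field_simps)
    then have "cos (pi / 3) \<le> cos \<bar>2 * pi * \<delta>\<bar>"
      by (intro cos_monotone_0_pi_le) (auto simp: abs_mult)
    then have cos: "1 / 2 \<le> cos (real (nat q) * Arg (c \<sigma>))"
      by (simp add: cos_60 arg abs_if split: if_splits)
    have "c \<sigma> ^ nat q = (rcis (cmod (c \<sigma>)) (Arg (c \<sigma>))) ^ nat q" by (simp add: rcis_cmod_Arg)
    then have "Re (c \<sigma> ^ nat q) = cmod (c \<sigma>) ^ nat q * cos (real (nat q) * Arg (c \<sigma>))"
      by (simp add: DeMoivre2)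
    also have "\<dots> \<ge> cmod (c \<sigma>) ^ nat q * (1 / 2)" using cos by (intro mult_left_mono) auto
    finally show ?thesis by simp
  qed
  then show thesis using that[of "nat q"] \<open>0 < q\<close> by simp
qed

text \<open>At the chosen exponent all terms have nonnegative real part, so the term of
  \<open>\<tau>\<close> is not cancelled. The power \<open>r\<close> is taken before approximating
  because \<open>q\<close> is only known to be positive and might be 1; the factor 2 in
  \<open>2 * B\<close> absorbs the loss of one half.\<close>

lemma power_sum_unbounded:
  fixes c :: "'s \<Rightarrow> complex"
  assumes "finite F" "\<tau> \<in> F" "cmod (c \<tau>) > 1"
  obtains k where "cmod (\<Sum>\<sigma>\<in>F. c \<sigma> ^ k) > B"
proof -
  obtain r where r: "2 * B < cmod (c \<tau>) ^ r"
    using real_arch_pow[OF assms(3)] by blast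
  obtain q where "q > 0" and q: "\<And>\<sigma>. \<sigma> \<in> F \<Longrightarrow> Re ((c \<sigma> ^ r) ^ q) \<ge> cmod (c \<sigma> ^ r) ^ q / 2"
    using power_sum_Re_lower_bound[OF assms(1), of "\<lambda>\<sigma>. c \<sigma> ^ r"] by blast
  have "Re ((c \<sigma> ^ r) ^ q) \<ge> 0" if "\<sigma> \<in> F" for \<sigma>
    using q[OF that] by (meson divide_nonneg_nonneg norm_ge_zero order_trans zero_le_numeral zero_le_power)
  then have "Re ((c \<tau> ^ r) ^ q) \<le> (\<Sum>\<sigma>\<in>F. Re ((c \<sigma> ^ r) ^ q))"
    using assms(1,2) by (intro member_le_sum) auto
  also have "\<dots> \<le> cmod (\<Sum>\<sigma>\<in>F. c \<sigma> ^ (r * q))"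
    using complex_Re_le_cmod[of "\<Sum>\<sigma>\<in>F. c \<sigma> ^ (r * q)"] by (simp add: power_mult)
  finally have *: "cmod (c \<tau> ^ r) ^ q / 2 \<le> cmod (\<Sum>\<sigma>\<in>F. c \<sigma> ^ (r * q))"
    using q[OF assms(2)] by linarith
  have "cmod (c \<tau>) ^ r \<le> cmod (c \<tau> ^ r) ^ q"
    using assms(3) \<open>q > 0\<close> by (simp add: norm_power self_le_power)
  then show thesis using * r that[of "r * q"] by simp
qed

section \<open>Sequence spaces\<close>

text \<open>Written as a partial sum of the basis expansion, so that the hypotheses on the basis
  apply literally; \<open>x\<close> ranges over all sequences, not only those in
  \<open>X\<close>.\<close>

definition truncation :: "nat \<Rightarrow> cseq \<Rightarrow> cseq" where
  "truncation m x = (\<Sum>j<m. seq_scale (x j) (unit_seq j))"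

lemma truncation_apply: "truncation m x = (\<lambda>i. if i < m then x i else 0)"
proof
  fix i
  have sum_apply: "(\<Sum>j\<in>J. f j) i = (\<Sum>j\<in>J. f j i)" for J and f :: "nat \<Rightarrow> cseq"
    by (induction J rule: infinite_finite_induct) auto
  have "truncation m x i = (\<Sum>j<m. if j = i then x j else 0)"
    unfolding truncation_def sum_apply
    by (intro sum.cong refl) (auto simp: seq_scale_def unit_seq_def)
  then show "truncation m x i = (if i < m then x i else 0)" by simp
qed

lemma truncation_mono:
  assumes "unconditional_with_constant nrm 1 unit_seq" and "\<And>j. j < m \<Longrightarrow> cmod (x j) \<le> cmod (y j)"
  shows "nrm (truncation m x) \<le> nrm (truncation m y)"
  using assms unfolding unconditional_with_constant_def truncation_def by simp

context complex_normed_sequence_space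
begin

interpretation V: vector_space seq_scale by (rule vector_space_seq_scale)

section \<open>Norms of truncations\<close>

lemma diff_in_X: "x \<in> X \<Longrightarrow> y \<in> X \<Longrightarrow> x - y \<in> X"
  using V.subspace_diff[OF subspace] .

lemma scale_in_X: "x \<in> X \<Longrightarrow> seq_scale c x \<in> X"
  using V.subspace_scale[OF subspace] .

lemma truncation_in_X:
  assumes "canonical_basis_is_schauder X nrm"
  shows "truncation m x \<in> X"
  using assms unfolding truncation_def canonical_basis_is_schauder_def schauder_basis_def
  by (intro V.subspace_sum[OF subspace] scale_in_X) auto

lemma truncation_approx:
  assumes "canonical_basis_is_schauder X nrm" "x \<in> X" "\<epsilon> > 0"
  shows "\<exists>N. \<forall>m\<ge>N. nrm (truncation m x - x) < \<epsilon>"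
proof -
  interpret M: Metric_space X "seq_dist X nrm" by (rule Metric_space_seq_dist)
  have "limitin M.mtopology (\<lambda>m. truncation m x) x sequentially"
    using assms unfolding canonical_basis_is_schauder_def series_converges_to_def seq_topology_def
      truncation_def by simp
  then obtain N where "\<forall>m\<ge>N. truncation m x \<in> X \<and> seq_dist X nrm (truncation m x) x < \<epsilon>"
    using assms(3) unfolding M.limit_metric_sequentially by blast
  then show ?thesis using assms(2) by (intro exI[of _ N]) (auto simp: seq_dist_def)
qed

text \<open>For \<open>m \<ge> M\<close> unconditionality bounds the truncation at \<open>M\<close>
  by the one at \<open>m\<close>, and the latter converges to \<open>x\<close>.\<close>

lemma nrm_truncation_le:
  assumes "canonical_basis_is_schauder X nrm" "unconditional_with_constant nrm 1 unit_seq" "x \<in> X"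
  shows "nrm (truncation M x) \<le> nrm x"
proof (rule field_le_epsilon)
  fix \<epsilon> :: real assume "\<epsilon> > 0"
  obtain N where N: "\<And>m. m \<ge> N \<Longrightarrow> nrm (truncation m x - x) < \<epsilon>"
    using truncation_approx[OF assms(1,3) \<open>\<epsilon> > 0\<close>] by blast
  define m where "m = max M N"
  have "truncation m (truncation M x) = truncation M x"
    by (auto simp: truncation_apply m_def fun_eq_iff)
  moreover have "nrm (truncation m (truncation M x)) \<le> nrm (truncation m x)"
    by (intro truncation_mono[OF assms(2)]) (simp add: truncation_apply)
  ultimately have "nrm (truncation M x) \<le> nrm (truncation m x)" by simp
  also have "\<dots> \<le> nrm x + nrm (truncation m x - x)"
    using nrm_triangle[OF assms(3) diff_in_X[OF truncation_in_X[OF assms(1)] assms(3)], of m x] by simp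
  also have "\<dots> \<le> nrm x + \<epsilon>" using N[of m] by (simp add: m_def)
  finally show "nrm (truncation M x) \<le> nrm x + \<epsilon>" .
qed

section \<open>Norming functionals on finitely many coordinates\<close>

lemma sublinear_nrm_truncation:
  assumes "canonical_basis_is_schauder X nrm"
  shows "sublinear (\<lambda>t. nrm (truncation m (\<lambda>j. of_real (t j))))"
  unfolding sublinear_def
proof (intro conjI allI impI)
  fix s t :: "nat \<Rightarrow> real"
  have "truncation m (\<lambda>j. of_real (s j + t j))
      = truncation m (\<lambda>j. of_real (s j)) + truncation m (\<lambda>j. of_real (t j))"
    by (auto simp: truncation_apply)
  then show "nrm (truncation m (\<lambda>j. of_real (s j + t j)))
      \<le> nrm (truncation m (\<lambda>j. of_real (s j))) + nrm (truncation m (\<lambda>j. of_real (t j)))"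
    by (simp add: nrm_triangle truncation_in_X[OF assms])
next
  fix c :: real and t :: "nat \<Rightarrow> real" assume "0 \<le> c"
  have "truncation m (\<lambda>j. of_real (c * t j)) = seq_scale (of_real c) (truncation m (\<lambda>j. of_real (t j)))"
    by (auto simp: truncation_apply seq_scale_def)
  then show "nrm (truncation m (\<lambda>j. of_real (c * t j))) = c * nrm (truncation m (\<lambda>j. of_real (t j)))"
    using \<open>0 \<le> c\<close> by (simp add: nrm_scale truncation_in_X[OF assms])
qed

text \<open>Real Hahn-Banach is enough: \<open>b\<close> supports the norm on real sequences at the
  moduli \<open>y\<close> of \<open>z\<close>, and the conjugate phases of \<open>z\<close> turn it
  into a complex functional. By 1-unconditionality, passing from \<open>z\<close> to its moduli
  preserves the norm of the truncation.\<close>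

lemma norming_functional:
  assumes basis: "canonical_basis_is_schauder X nrm"
    and uncond: "unconditional_with_constant nrm 1 unit_seq"
  obtains a where "\<And>w. cmod (\<Sum>j<m. a j * w j) \<le> nrm (truncation m w)"
    and "(\<Sum>j<m. a j * z j) = of_real (nrm (truncation m z))"
proof -
  define p where "p t = nrm (truncation m (\<lambda>j. of_real (t j)))" for t
  have p: "sublinear p" unfolding p_def by (rule sublinear_nrm_truncation[OF basis])
  define y where "y j = (if j < m then cmod (z j) else 0)" for j
  obtain b where b: "\<And>t. (\<And>i. i \<notin> {..<m} \<Longrightarrow> t i = 0) \<Longrightarrow> (\<Sum>j<m. b j * t j) \<le> p t"
    and b_eq: "(\<Sum>j<m. b j * y j) = p y"
    using sublinear_supporting_functional[OF finite_lessThan p, of m y] by (auto simp: y_def)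
  define a where "a j = of_real (b j) * cnj (sgn (z j))" for j
  \<comment> \<open>Only an inequality, as \<open>sgn 0 = 0\<close> makes \<open>a j\<close> vanish
    wherever \<open>z j = 0\<close>.\<close>
  have cmod_a: "cmod (a j) \<le> \<bar>b j\<bar>" for j
    by (simp add: a_def norm_mult norm_sgn)
  have "cmod (\<Sum>j<m. a j * w j) \<le> nrm (truncation m w)" for w
  proof -
    \<comment> \<open>The signs make \<open>b j * t j\<close> equal to
      \<open>\<bar>b j\<bar> * cmod (w j)\<close>, while \<open>t\<close> stays dominated by
      \<open>w\<close> in modulus.\<close>
    define t where "t j = (if j < m then sgn (b j) * cmod (w j) else 0)" for j
    have "cmod (\<Sum>j<m. a j * w j) \<le> (\<Sum>j<m. cmod (a j * w j))" by (rule norm_sum)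
    also have "\<dots> \<le> (\<Sum>j<m. \<bar>b j\<bar> * cmod (w j))"
      using cmod_a by (intro sum_mono) (auto simp: norm_mult intro: mult_right_mono)
    also have "\<dots> = (\<Sum>j<m. b j * t j)"
      by (intro sum.cong refl) (simp add: t_def abs_sgn mult.assoc)
    also have "\<dots> \<le> p t" by (intro b) (auto simp: t_def)
    also have "\<dots> \<le> nrm (truncation m w)"
      unfolding p_def by (intro truncation_mono[OF uncond]) (auto simp: t_def norm_mult abs_sgn_eq)
    finally show ?thesis .
  qed
  moreover have "(\<Sum>j<m. a j * z j) = of_real (nrm (truncation m z))"
  proof -
    have phase: "cnj (sgn w) * w = of_real (cmod w)" for w
    proof -
      have "cnj (sgn w) * w = (w * cnj w) / of_real (cmod w)" by (simp add: sgn_eq)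
      also have "w * cnj w = of_real (cmod w) * of_real (cmod w)"
        using complex_norm_square[of w] unfolding power2_eq_square of_real_mult by (rule sym)
      finally show ?thesis by simp
    qed
    have "(\<Sum>j<m. a j * z j) = of_real (p y)"
      by (simp add: a_def y_def mult.assoc phase flip: b_eq)
    \<comment> \<open>The coordinates of \<open>y\<close> and \<open>z\<close> below
      \<open>m\<close> have equal moduli, so unconditionality applies in both directions.\<close>
    also have "p y = nrm (truncation m z)"
      unfolding p_def by (intro antisym truncation_mono[OF uncond]) (auto simp: y_def)
    finally show ?thesis .
  qed
  ultimately show thesis by (rule that)
qed

section \<open>Polynomials from power sums, and norm bounds for the group action\<close>

lemma continuous_homogeneous_polynomial_power_sum:
  fixes L :: "'s \<Rightarrow> cseq \<Rightarrow> complex"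
  assumes "finite F"
    and add: "\<And>\<sigma> x y. \<sigma> \<in> F \<Longrightarrow> L \<sigma> (x + y) = L \<sigma> x + L \<sigma> y"
    and scale: "\<And>\<sigma> c x. \<sigma> \<in> F \<Longrightarrow> L \<sigma> (seq_scale c x) = c * L \<sigma> x"
    and bound: "\<And>\<sigma> x. \<sigma> \<in> F \<Longrightarrow> x \<in> X \<Longrightarrow> cmod (L \<sigma> x) \<le> nrm x"
  shows "continuous_homogeneous_polynomial X nrm k (\<lambda>x. \<Sum>\<sigma>\<in>F. L \<sigma> x ^ k)"
proof -
  interpret M: Metric_space X "seq_dist X nrm" by (rule Metric_space_seq_dist)
  \<comment> \<open>The form whose diagonal is the power sum; for \<open>k = 0\<close> both are the
    constant \<open>card F\<close>.\<close>
  define A where "A v = (\<Sum>\<sigma>\<in>F. \<Prod>j<k. L \<sigma> (v ! j))" for v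
  \<comment> \<open>The remaining product does not involve the entry at position \<open>i\<close>,
    so multilinearity reduces to linearity of each \<open>L \<sigma>\<close>.\<close>
  have split: "A (v[i := u]) = (\<Sum>\<sigma>\<in>F. L \<sigma> u * (\<Prod>j\<in>{..<k} - {i}. L \<sigma> (v ! j)))"
    if "length v = k" "i < k" for v i u
    unfolding A_def
  proof (intro sum.cong refl)
    fix \<sigma>
    have "(\<Prod>j<k. L \<sigma> (v[i := u] ! j))
        = L \<sigma> (v[i := u] ! i) * (\<Prod>j\<in>{..<k} - {i}. L \<sigma> (v[i := u] ! j))"
      using that by (intro prod.remove) auto
    also have "(\<Prod>j\<in>{..<k} - {i}. L \<sigma> (v[i := u] ! j)) = (\<Prod>j\<in>{..<k} - {i}. L \<sigma> (v ! j))"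
      by (intro prod.cong) auto
    finally show "(\<Prod>j<k. L \<sigma> (v[i := u] ! j)) = L \<sigma> u * (\<Prod>j\<in>{..<k} - {i}. L \<sigma> (v ! j))"
      using that by simp
  qed
  have "multilinear_form X k A"
    unfolding multilinear_form_def
    by (auto simp: split add scale algebra_simps sum.distrib sum_distrib_left)
  moreover have "(\<Sum>\<sigma>\<in>F. L \<sigma> x ^ k) = A (replicate k x)" for x
    by (simp add: A_def)
  ultimately have "homogeneous_polynomial X k (\<lambda>x. \<Sum>\<sigma>\<in>F. L \<sigma> x ^ k)"
    unfolding homogeneous_polynomial_def by blast
  moreover have "continuous_map M.mtopology euclidean (L \<sigma>)" if "\<sigma> \<in> F" for \<sigma>
  proof -
    \<comment> \<open>Additivity turns the norm bound at \<open>x - y\<close> into a Lipschitz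
      estimate with constant 1.\<close>
    have "dist (L \<sigma> x) (L \<sigma> y) \<le> seq_dist X nrm x y" if "x \<in> X" "y \<in> X" for x y
      using bound[OF \<open>\<sigma> \<in> F\<close> diff_in_X[OF that]] add[OF \<open>\<sigma> \<in> F\<close>, of "x - y" y] that
      by (simp add: seq_dist_def dist_norm)
    then have "\<forall>x\<in>X. \<forall>\<epsilon>>0. \<exists>\<delta>>0. \<forall>y. y \<in> X \<and> seq_dist X nrm x y < \<delta> \<longrightarrow> dist (L \<sigma> x) (L \<sigma> y) < \<epsilon>"
      by (meson order_le_less_trans)
    then show ?thesis
      using M.metric_continuous_map[OF Met_TC.Metric_space_axioms, of "L \<sigma>"] by simp
  qed
  then have "continuous_map M.mtopology euclidean (\<lambda>x. \<Sum>\<sigma>\<in>F. L \<sigma> x ^ k)"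
    using assms(1) by (simp add: continuous_map_atin tendsto_sum tendsto_power)
  ultimately show ?thesis
    by (simp add: continuous_homogeneous_polynomial_def seq_topology_def)
qed

text \<open>Normalising \<open>x\<close> puts it into the unit ball, which \<open>\<gamma>\<close>
  preserves, and homogeneity along \<open>x\<close> undoes the scaling. The zero vector cannot be
  normalised, but homogeneity with \<open>c = 0\<close> shows that it is fixed.\<close>

lemma nrm_invariant_le:
  assumes "defines_action G X" "invariant_set G (unit_cball X nrm)" "\<gamma> \<in> G" "x \<in> X"
    and \<gamma>: "\<And>c. \<gamma> (seq_scale c x) = seq_scale c (\<gamma> x)"
  shows "nrm (\<gamma> x) \<le> nrm x"
proof (cases "x = 0")
  case True
  have "seq_scale 0 y = 0" for y by (rule V.scale_zero_left)
  then have "\<gamma> x = x" using \<gamma>[of 0] True by simp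
  then show ?thesis by simp
next
  case False
  then have pos: "nrm x > 0"
    using nrm_nonneg[OF assms(4)] nrm_eq_0_iff[OF assms(4)] by linarith
  let ?c = "complex_of_real (inverse (nrm x))"
  have "seq_scale ?c x \<in> unit_cball X nrm"
    using pos assms(4) by (simp add: unit_cball_def scale_in_X nrm_scale norm_inverse)
  then have "seq_scale ?c (\<gamma> x) \<in> unit_cball X nrm"
    using assms(2,3) \<gamma> unfolding invariant_set_def by (metis image_subset_iff)
  moreover have "\<gamma> x \<in> X" using assms(1,3,4) unfolding defines_action_def by blast
  ultimately have "inverse (nrm x) * nrm (\<gamma> x) \<le> 1"
    using pos by (simp add: unit_cball_def nrm_scale norm_inverse)
  then show ?thesis using pos by (simp add: field_simps)
qed

end

section \<open>Block permutations\<close>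

text \<open>A finite subgroup standing in for the possibly infinite full group. When
  \<open>m\<close> is the end of a block, it realises every permutation that block permutations
  induce on the indices below \<open>m\<close>.\<close>

definition block_perms_below :: "(nat \<Rightarrow> nat) \<Rightarrow> nat \<Rightarrow> (nat \<Rightarrow> nat) set" where
  "block_perms_below n m = {\<sigma> \<in> block_perms n. \<sigma> permutes {..<m}}"

lemma finite_block_perms_below: "finite (block_perms_below n m)"
  unfolding block_perms_below_def
  by (rule finite_subset[OF _ finite_permutations[of "{..<m}"]]) auto

lemma id_block_perms_below: "id \<in> block_perms_below n m"
  by (simp add: block_perms_below_def block_perms_def permutes_id)

lemma lessThan_Un_blocks:
  assumes "strict_mono n" "n 0 = 0"
  shows "{..<n K} = (\<Union>k<K. block n k)"
proof (induction K)
  case (Suc K)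
  have "n K \<le> n (Suc K)" using assms(1) by (simp add: strict_mono_def less_imp_le)
  then have "{..<n (Suc K)} = {..<n K} \<union> block n K" by (auto simp: block_def)
  then show ?case by (simp add: Suc lessThan_Suc Un_commute)
qed (simp add: assms(2))

lemma block_perms_compose:
  "\<sigma> \<in> block_perms n \<Longrightarrow> \<tau> \<in> block_perms n \<Longrightarrow> \<sigma> \<circ> \<tau> \<in> block_perms n"
  by (simp add: block_perms_def bij_comp image_comp[symmetric, of \<sigma> \<tau>] del: o_apply image_comp)

text \<open>As \<open>n K\<close> is a block boundary, \<open>\<tau>\<close> maps the indices below
  it onto themselves; earlier blocks are moved as by \<open>\<tau>\<close>, later ones are fixed
  pointwise.\<close>

lemma block_perms_restrict:
  assumes n: "strict_mono n" "n 0 = 0" and \<tau>: "\<tau> \<in> block_perms n"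
  shows "(\<lambda>j. if j < n K then \<tau> j else j) \<in> block_perms_below n (n K)"
    (is "?\<rho> \<in> _")
proof -
  have "\<tau> ` {..<n K} = {..<n K}"
    using \<tau> unfolding lessThan_Un_blocks[OF n] block_perms_def by (simp add: image_UN)
  moreover have "inj_on \<tau> {..<n K}" using \<tau> by (auto simp: block_perms_def bij_def inj_def inj_on_def)
  ultimately have "bij_betw \<tau> {..<n K} {..<n K}" by (simp add: bij_betw_def)
  then have "bij_betw ?\<rho> {..<n K} {..<n K}" by (subst bij_betw_cong[of _ _ \<tau>]) auto
  then have perm: "?\<rho> permutes {..<n K}" by (rule bij_imp_permutes) simp
  have "?\<rho> ` block n k = block n k" for k
  proof (cases "k < K")
    case True
    then have "block n k \<subseteq> {..<n K}" unfolding lessThan_Un_blocks[OF n] by blast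
    then have "?\<rho> ` block n k = \<tau> ` block n k" by (intro image_cong) auto
    then show ?thesis using \<tau> by (simp add: block_perms_def)
  next
    case False
    then have "n K \<le> n k" using n(1) by (simp add: strict_mono_less_eq)
    then have "?\<rho> ` block n k = id ` block n k" by (intro image_cong) (auto simp: block_def)
    then show ?thesis by simp
  qed
  then show ?thesis using perm permutes_bij[OF perm] by (simp add: block_perms_below_def block_perms_def)
qed

text \<open>Left translation is injective because \<open>\<rho>\<close> is, and an injective
  self-map of a finite set is onto.\<close>

lemma bij_betw_block_perms_below:
  assumes "\<rho> \<in> block_perms_below n m"
  shows "bij_betw ((\<circ>) \<rho>) (block_perms_below n m) (block_perms_below n m)"
proof -
  have "inj_on ((\<circ>) \<rho>) (block_perms_below n m)"
    using assms fun.inj_map[OF permutes_inj, of \<rho> "{..<m}"]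
    by (auto simp: block_perms_below_def intro: inj_on_subset)
  moreover have "(\<circ>) \<rho> ` block_perms_below n m \<subseteq> block_perms_below n m"
    using assms by (auto simp: block_perms_below_def intro: block_perms_compose permutes_compose)
  ultimately show ?thesis
    using finite_block_perms_below by (simp add: bij_betw_def endo_inj_surj)
qed

section \<open>Construction of the separating polynomial\<close>

theorem corollary4p6:
  fixes n :: "nat \<Rightarrow> nat" and X :: "(nat \<Rightarrow> complex) set"
    and nrm :: "(nat \<Rightarrow> complex) \<Rightarrow> real" and z :: "nat \<Rightarrow> complex"
  assumes "strict_mono n" and "n 0 = 0"
    and "complex_banach_sequence_space X nrm"
    and "canonical_basis_is_schauder X nrm"
    and "unconditional_with_constant nrm 1 unit_seq"
    and "defines_action (hat_S n) X"
    and "invariant_set (hat_S n) (unit_cball X nrm)"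
    and "z \<in> X" and "z \<notin> unit_cball X nrm"
  shows "\<exists>m P. continuous_homogeneous_polynomial X nrm m P \<and>
               invariant_fun (hat_S n) X P \<and>
               separates P z (unit_cball X nrm)"
proof -
  interpret complex_banach_sequence_space X nrm by fact
  have "nrm z > 1" using assms(8,9) by (simp add: unit_cball_def)
  then obtain N where N: "\<And>m. m \<ge> N \<Longrightarrow> nrm (truncation m z - z) < nrm z - 1"
    using truncation_approx[OF assms(4,8), of "nrm z - 1"] by auto
  \<comment> \<open>A block boundary at or beyond \<open>N\<close>: far enough to keep the truncated
    norm above 1, and compatible with restricting block permutations.\<close>
  define M where "M = n N"
  have "N \<le> M" unfolding M_def using assms(1) by (rule strict_mono_imp_increasing)
  have "nrm z \<le> nrm (truncation M z) + nrm (z - truncation M z)"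
    using nrm_triangle[OF truncation_in_X[OF assms(4)] diff_in_X[OF assms(8) truncation_in_X[OF assms(4)]],
      of M z M z] by simp
  also have "nrm (z - truncation M z) = nrm (truncation M z - z)"
    using nrm_scale[OF diff_in_X[OF assms(8) truncation_in_X[OF assms(4)]], of "-1" M z]
    by (simp add: seq_scale_def fun_diff_def)
  finally have zM: "nrm (truncation M z) > 1" using N[OF \<open>N \<le> M\<close>] by simp

  obtain a where a: "\<And>w. cmod (\<Sum>j<M. a j * w j) \<le> nrm (truncation M w)"
    and az: "(\<Sum>j<M. a j * z j) = of_real (nrm (truncation M z))"
    using norming_functional[OF assms(4,5)] by blast
  define F where "F = block_perms_below n M"
  \<comment> \<open>The norming functional composed with \<open>hat \<sigma>\<close>.\<close>
  define L where "L \<sigma> x = (\<Sum>j<M. a j * x (\<sigma> j))" for \<sigma> :: "nat \<Rightarrow> nat" and x :: cseq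
  have "finite F" by (simp add: F_def finite_block_perms_below)
  have "id \<in> F" by (simp add: F_def id_block_perms_below)
  \<comment> \<open>Truncation does not increase the norm by unconditionality, nor does
    \<open>hat \<sigma>\<close> by invariance of the ball.\<close>
  have bound: "cmod (L \<sigma> x) \<le> nrm x" if "\<sigma> \<in> F" "x \<in> X" for \<sigma> x
  proof -
    have hat: "hat \<sigma> \<in> hat_S n" using that by (simp add: F_def block_perms_below_def hat_S_def)
    have "cmod (L \<sigma> x) \<le> nrm (truncation M (hat \<sigma> x))"
      using a[of "hat \<sigma> x"] by (simp add: L_def hat_def)
    also have "\<dots> \<le> nrm (hat \<sigma> x)"
      using assms(6) hat that by (intro nrm_truncation_le assms) (auto simp: defines_action_def)
    also have "\<dots> \<le> nrm x"
      using that by (intro nrm_invariant_le[OF assms(6,7) hat]) (auto simp: hat_def seq_scale_def)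
    finally show ?thesis .
  qed
  have "cmod (L id z) > 1" using az zM by (simp add: L_def)
  \<comment> \<open>The threshold \<open>card F\<close> is the bound for the power sum on the unit
    ball. It also excludes \<open>k = 0\<close>, where the sum is exactly
    \<open>card F\<close>.\<close>
  then obtain k where k: "cmod (\<Sum>\<sigma>\<in>F. L \<sigma> z ^ k) > real (card F)"
    using power_sum_unbounded[OF \<open>finite F\<close> \<open>id \<in> F\<close>, of "\<lambda>\<sigma>. L \<sigma> z"] by blast
  define P where "P x = (\<Sum>\<sigma>\<in>F. L \<sigma> x ^ k)" for x
  have "continuous_homogeneous_polynomial X nrm k P"
    unfolding P_def
    by (rule continuous_homogeneous_polynomial_power_sum[OF \<open>finite F\<close> _ _ bound])
      (auto simp: L_def seq_scale_def algebra_simps sum.distrib sum_distrib_left)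
  moreover have "invariant_fun (hat_S n) X P"
    unfolding invariant_fun_def hat_S_def
  proof safe
    fix \<tau> x assume \<tau>: "\<tau> \<in> block_perms n"
    define \<rho> where "\<rho> = (\<lambda>j. if j < M then \<tau> j else j)"
    have \<rho>: "\<rho> \<in> F" using block_perms_restrict[OF assms(1,2) \<tau>] by (simp add: F_def \<rho>_def M_def)
    \<comment> \<open>\<open>\<sigma>\<close> keeps the indices below \<open>M\<close> there, and on
      them \<open>\<tau>\<close> and \<open>\<rho>\<close> agree. So \<open>hat \<tau>\<close> acts
      as left translation by \<open>\<rho>\<close>, which only permutes the summands of
      \<open>P\<close>.\<close>
    have "L \<sigma> (hat \<tau> x) = L (\<rho> \<circ> \<sigma>) x" if "\<sigma> \<in> F" for \<sigma>
    proof -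
      have "\<sigma> j < M" if "j < M" for j
        using \<open>\<sigma> \<in> F\<close> that permutes_in_image[of \<sigma> "{..<M}" j] by (simp add: F_def block_perms_below_def)
      then show ?thesis by (simp add: L_def hat_def \<rho>_def)
    qed
    then have "P (hat \<tau> x) = (\<Sum>\<sigma>\<in>F. L (\<rho> \<circ> \<sigma>) x ^ k)" by (simp add: P_def)
    also have "\<dots> = P x"
      unfolding P_def using bij_betw_block_perms_below[of \<rho> n M] \<rho>
      by (intro sum.reindex_bij_betw[of "(\<circ>) \<rho>"]) (simp add: F_def)
    finally show "P (hat \<tau> x) = P x" .
  qed
  moreover have "separates P z (unit_cball X nrm)"
  proof -
    have "cmod (P w) \<le> real (card F)" if "w \<in> unit_cball X nrm" for w
    proof -
      have "cmod (P w) \<le> (\<Sum>\<sigma>\<in>F. cmod (L \<sigma> w ^ k))" unfolding P_def by (rule norm_sum)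
      also have "\<dots> \<le> (\<Sum>\<sigma>\<in>F. 1)"
        using that bound by (intro sum_mono) (force simp: unit_cball_def norm_power intro!: power_le_one)
      finally show ?thesis by simp
    qed
    then have "(SUP w\<in>unit_cball X nrm. ereal (cmod (P w))) \<le> ereal (real (card F))"
      by (intro SUP_least) simp
    also have "\<dots> < ereal (cmod (P z))" using k by (simp add: P_def)
    finally show ?thesis by (simp add: separates_def)
  qed
  ultimately show ?thesis by blast
qed

end
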